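(* For each prime $p\ge5$ let $G_p=(\mathbb Z/p\mathbb Z)^2$ and $\tau_p=(p,p,p)$, and let $\{S_p\}$ be the family of Beauville surfaces with group $G_p$ admitting a ramification structure of type $(\tau_p,\tau_p)$. Let $h(G_p;\tau_p,\tau_p)$ denote the number of Beauville surfaces admitting these data (i.e. the number of Hurwitz components). Then, as $p\to\infty$, $$h(G_p;\tau_p,\tau_p)=\Theta\bigl(\chi^2(S_p)\bigr).$$
   Context: Systems of generators. For a finite group $G$ and a triple $\tau=(m_1,m_2,m_3)$ of positive integers, a system of generators of $G$ of type $\tau$ is a triple $\mathcal V=(c_1,c_2,c_3)$ of elements generating $G$ with $c_1c_2c_3=1$ and $\mathrm{ord}(c_i)=m_i$; it is of unordered type $\tau$ if the orders agree with $\tau$ up to a permutation. Put $\Sigma(\mathcal V)=\bigcup_{g\in G}\bigcup_{j\ge 0}\bigcup_{k=1}^3\{gc_k^jg^{-1}\}$; two systems $\mathcal V_1,\mathcal V_2$ are disjoint if $\Sigma(\mathcal V_1)\cap\Sigma(\mathcal V_2)=\{1\}$. A Beauville ramification structure of type $(\tau_1,\tau_2)$ for $G$, where $\tau_i=(m_{i,1},m_{i,2},m_{i,3})$, is a pair $(\mathcal V_1,\mathcal V_2)$ of disjoint systems of generators of types $\tau_1,\tau_2$ such that $\tfrac12|G|\bigl(-2+\sum_{l=1}^{3}(1-\tfrac1{m_{i,l}})\bigr)+1$ is an integer $\ge 2$ for $i=1,2$. "Ramification structure of type $\tau$" abbreviates type $(\tau,\tau)$. Let $\mathcal U(G;\tau_1,\tau_2)$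 be the set of all pairs $(\mathcal V_1,\mathcal V_2)$ of disjoint systems of generators with $\mathcal V_i$ of unordered type $\tau_i$. Beauville surfaces. A Beauville surface (of unmixed type) with group $G$ is $S=(C_1\times C_2)/G$, where $C_1,C_2$ are smooth compact complex curves of genus at least $2$, the finite group $G$ acts faithfully on each $C_i$ and freely and diagonally on $C_1\times C_2$, $C_i/G\cong\mathbb P^1$, and each covering $C_i\to C_i/G$ is branched in exactly $3$ points. Such a surface is determined via monodromy by $G$ and a Beauville ramification structure of type $(\tau_1,\tau_2)$, where $\tau_i$ lists the branching indices of $C_i\to\mathbb P^1$. The holomorphic Euler characteristic is $\chi(S)=\frac{(g(C_1)-1)(g(C_2)-1)}{|G|}$, equivalently $4\chi(S)=|G|(1-\mu_1)(1-\mu_2)$, where $\mu_i$ is the sum of the reciprocals of the three entries of $\tau_i$. Hurwitz components. The braid group $\mathbf B_3=\langle\sigma_1,\sigma_2\mid\sigma_1\sigma_2\sigma_1=\sigma_2\sigma_1\sigma_2\rangle$ acts on triples by $\sigma_1:(c_1,c_2,c_3)\mapsto(c_2,c_2^{-1}c_1c_2,c_3)$ and $\sigma_2:(c_1,c_2,c_3)\mapsto(c_1,c_3,c_3^{-1}c_2c_3)$. For $\tau_1=\tau_2=\tau$, the number $h(G;\tau,\tau)$ of Hurwitz components, which is the number of Beauville surfaces with the given data, is the number of orbits of $\mathcal U(G;\tau,\tau)$ under $(\mathbf B_3\wr\mathbb Z/2\mathbb Z)\times\mathrm{Aut}(G)$, where $((\gamma_1,\gamma_2),\phi)\cdot(T_1,T_2)=(\phi(\gamma_1(T_1)),\phi(\gamma_2(T_2)))$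 and $\mathbb Z/2\mathbb Z$ exchanges $T_1$ and $T_2$. Asymptotics. $f=\Theta(g)$ means $c_1g\le f\le c_2g$ for some positive constants $c_1,c_2$, as the parameter tends to infinity. *)

theory Defs
  imports
    "HOL-Algebra.Algebra"
    "HOL-Library.Landau_Symbols"
    "HOL-Number_Theory.Cong"
begin

type_synonym 'a triple = "'a \<times> 'a \<times> 'a"

section \<open>Systems of generators and Beauville ramification structures\<close>

text \<open>
  The group is a parameter of every notion below; they are meant for finite groups, where all
  element orders are positive.
\<close>

fun generating_system :: "('a, 'b) monoid_scheme \<Rightarrow> 'a triple \<Rightarrow> bool" where
  "generating_system G (c1, c2, c3) \<longleftrightarrow>
     c1 \<in> carrier G \<and> c2 \<in> carrier G \<and> c3 \<in> carrier G \<and>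
     generate G {c1, c2, c3} = carrier G \<and> c1 \<otimes>\<^bsub>G\<^esub> c2 \<otimes>\<^bsub>G\<^esub> c3 = \<one>\<^bsub>G\<^esub>"

fun type_of :: "('a, 'b) monoid_scheme \<Rightarrow> 'a triple \<Rightarrow> nat triple" where
  "type_of G (c1, c2, c3) = (group.ord G c1, group.ord G c2, group.ord G c3)"

fun mset_triple :: "'a triple \<Rightarrow> 'a multiset" where
  "mset_triple (x, y, z) = {#x, y, z#}"

definition of_type :: "('a, 'b) monoid_scheme \<Rightarrow> nat triple \<Rightarrow> 'a triple \<Rightarrow> bool" where
  "of_type G \<tau> V \<longleftrightarrow> generating_system G V \<and> type_of G V = \<tau>"

definition of_unordered_type :: "('a, 'b) monoid_scheme \<Rightarrow> nat triple \<Rightarrow> 'a triple \<Rightarrow> bool" where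
  "of_unordered_type G \<tau> V \<longleftrightarrow>
     generating_system G V \<and> mset_triple (type_of G V) = mset_triple \<tau>"

fun stabilizer_set :: "('a, 'b) monoid_scheme \<Rightarrow> 'a triple \<Rightarrow> 'a set" where
  "stabilizer_set G (c1, c2, c3) =
     (\<Union>g\<in>carrier G. \<Union>j::nat. \<Union>c\<in>{c1, c2, c3}.
        {g \<otimes>\<^bsub>G\<^esub> c [^]\<^bsub>G\<^esub> j \<otimes>\<^bsub>G\<^esub> inv\<^bsub>G\<^esub> g})"

definition disjoint_systems :: "('a, 'b) monoid_scheme \<Rightarrow> 'a triple \<Rightarrow> 'a triple \<Rightarrow> bool" where
  "disjoint_systems G V1 V2 \<longleftrightarrow> stabilizer_set G V1 \<inter> stabilizer_set G V2 = {\<one>\<^bsub>G\<^esub>}"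

text \<open>
  The genus of a \<open>G\<close>-cover of the projective line branched in three points with branching
  indices \<open>\<tau>\<close>, as given by the Riemann-Hurwitz formula.
\<close>

fun cover_genus :: "('a, 'b) monoid_scheme \<Rightarrow> nat triple \<Rightarrow> real" where
  "cover_genus G (m1, m2, m3) =
     1 / 2 * real (order G) *
       (- 2 + ((1 - 1 / real m1) + (1 - 1 / real m2) + (1 - 1 / real m3))) + 1"

fun beauville_structure ::
  "('a, 'b) monoid_scheme \<Rightarrow> nat triple \<Rightarrow> nat triple \<Rightarrow> 'a triple \<times> 'a triple \<Rightarrow> bool" where
  "beauville_structure G \<tau>1 \<tau>2 (V1, V2) \<longleftrightarrow>
     of_type G \<tau>1 V1 \<and> of_type G \<tau>2 V2 \<and> disjoint_systems G V1 V2 \<and>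
     (\<forall>\<tau>\<in>{\<tau>1, \<tau>2}. cover_genus G \<tau> \<in> \<int> \<and> 2 \<le> cover_genus G \<tau>)"

text \<open>
  A Beauville surface \<open>(C\<^sub>1 \<times> C\<^sub>2) / G\<close> is represented by its monodromy, a Beauville ramification
  structure \<open>(V1, V2)\<close> for \<open>G\<close>. The curve \<open>C\<^sub>i\<close> is then the cover with branching indices the orders
  of the entries of \<open>Vi\<close>, and \<open>euler_char\<close> is
  \<open>\<chi>(S) = (g(C\<^sub>1) - 1) (g(C\<^sub>2) - 1) / |G|\<close>.
\<close>

fun euler_char :: "('a, 'b) monoid_scheme \<Rightarrow> 'a triple \<times> 'a triple \<Rightarrow> real" where
  "euler_char G (V1, V2) =
     (cover_genus G (type_of G V1) - 1) * (cover_genus G (type_of G V2) - 1) / real (order G)"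

section \<open>Hurwitz components\<close>

definition disjoint_pairs ::
  "('a, 'b) monoid_scheme \<Rightarrow> nat triple \<Rightarrow> nat triple \<Rightarrow> ('a triple \<times> 'a triple) set" where
  "disjoint_pairs G \<tau>1 \<tau>2 =
     {(V1, V2). of_unordered_type G \<tau>1 V1 \<and> of_unordered_type G \<tau>2 V2 \<and> disjoint_systems G V1 V2}"

abbreviation triples :: "('a, 'b) monoid_scheme \<Rightarrow> 'a triple set" where
  "triples G \<equiv> carrier G \<times> carrier G \<times> carrier G"

definition braid1 :: "('a, 'b) monoid_scheme \<Rightarrow> 'a triple \<Rightarrow> 'a triple" where
  "braid1 G = (\<lambda>(c1, c2, c3)\<in>triples G. (c2, inv\<^bsub>G\<^esub> c2 \<otimes>\<^bsub>G\<^esub> c1 \<otimes>\<^bsub>G\<^esub> c2, c3))"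

definition braid2 :: "('a, 'b) monoid_scheme \<Rightarrow> 'a triple \<Rightarrow> 'a triple" where
  "braid2 G = (\<lambda>(c1, c2, c3)\<in>triples G. (c1, c3, inv\<^bsub>G\<^esub> c3 \<otimes>\<^bsub>G\<^esub> c2 \<otimes>\<^bsub>G\<^esub> c3))"

text \<open>
  The image of the braid group \<open>B\<^sub>3 = \<langle>\<sigma>\<^sub>1, \<sigma>\<^sub>2 | \<sigma>\<^sub>1 \<sigma>\<^sub>2 \<sigma>\<^sub>1 = \<sigma>\<^sub>2 \<sigma>\<^sub>1 \<sigma>\<^sub>2\<rangle>\<close> in the group of permutations
  of the triples of elements of \<open>G\<close>. Since \<open>B\<^sub>3\<close> is generated by \<open>\<sigma>\<^sub>1\<close> and \<open>\<sigma>\<^sub>2\<close>, this is the subgroup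
  generated by their images, and it has the same orbits as \<open>B\<^sub>3\<close> itself.
\<close>

definition braid_perms :: "('a, 'b) monoid_scheme \<Rightarrow> ('a triple \<Rightarrow> 'a triple) set" where
  "braid_perms G = generate (BijGroup (triples G)) {braid1 G, braid2 G}"

definition map_triple :: "('a \<Rightarrow> 'c) \<Rightarrow> 'a triple \<Rightarrow> 'c triple" where
  "map_triple f = map_prod f (map_prod f f)"

text \<open>
  The orbit of a pair under \<open>(B\<^sub>3 \<wr> \<int>/2\<int>) \<times> Aut(G)\<close>: an element of the wreath product is
  \<open>(\<gamma>1, \<gamma>2)\<close>, possibly preceded by the exchange of the two components.
\<close>

definition hurwitz_orbit ::
  "('a, 'b) monoid_scheme \<Rightarrow> 'a triple \<times> 'a triple \<Rightarrow> ('a triple \<times> 'a triple) set" where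
  "hurwitz_orbit G P =
     {(map_triple \<phi> (\<gamma>1 T1), map_triple \<phi> (\<gamma>2 T2)) | \<phi> \<gamma>1 \<gamma>2 T1 T2.
        \<phi> \<in> iso G G \<and> \<gamma>1 \<in> braid_perms G \<and> \<gamma>2 \<in> braid_perms G \<and>
        (T1, T2) \<in> {P, prod.swap P}}"

text \<open>The number of Hurwitz components \<open>h(G; \<tau>, \<tau>)\<close>.\<close>

definition hurwitz_number :: "('a, 'b) monoid_scheme \<Rightarrow> nat triple \<Rightarrow> nat" where
  "hurwitz_number G \<tau> = card (hurwitz_orbit G ` disjoint_pairs G \<tau> \<tau>)"

lemma braid_in_Bij:
  assumes "group G"
  shows "braid1 G \<in> Bij (triples G)" "braid2 G \<in> Bij (triples G)"
proof -
  interpret group G by fact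
  have *: "x \<otimes>\<^bsub>G\<^esub> (inv\<^bsub>G\<^esub> x \<otimes>\<^bsub>G\<^esub> y) = y" "inv\<^bsub>G\<^esub> x \<otimes>\<^bsub>G\<^esub> (x \<otimes>\<^bsub>G\<^esub> y) = y"
    if "x \<in> carrier G" "y \<in> carrier G" for x y
    using that by (simp_all flip: m_assoc)
  have "bij_betw (braid1 G) (triples G) (triples G)"
    by (rule bij_betw_byWitness[where f' = "\<lambda>(a, b, c). (a \<otimes>\<^bsub>G\<^esub> b \<otimes>\<^bsub>G\<^esub> inv\<^bsub>G\<^esub> a, a, c)"])
       (auto simp: braid1_def m_assoc *)
  moreover have "bij_betw (braid2 G) (triples G) (triples G)"
    by (rule bij_betw_byWitness[where f' = "\<lambda>(a, b, c). (a, b \<otimes>\<^bsub>G\<^esub> c \<otimes>\<^bsub>G\<^esub> inv\<^bsub>G\<^esub> b, b)"])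
       (auto simp: braid2_def m_assoc *)
  ultimately show "braid1 G \<in> Bij (triples G)" "braid2 G \<in> Bij (triples G)"
    by (simp_all add: Bij_def braid1_def braid2_def)
qed

lemma braid_relation:
  assumes "group G" "T \<in> triples G"
  shows "braid1 G (braid2 G (braid1 G T)) = braid2 G (braid1 G (braid2 G T))"
proof -
  interpret group G by fact
  have [simp]: "x \<otimes>\<^bsub>G\<^esub> (inv\<^bsub>G\<^esub> x \<otimes>\<^bsub>G\<^esub> y) = y"
    if "x \<in> carrier G" "y \<in> carrier G" for x y
    using that by (simp flip: m_assoc)
  show ?thesis using assms(2)
    by (auto simp: braid1_def braid2_def m_assoc inv_mult_group)
qed

section \<open>The groups \<open>(\<int>/p\<int>)\<^sup>2\<close>\<close>

definition zmod_square :: "nat \<Rightarrow> (int \<times> int) monoid" where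
  "zmod_square p = integer_mod_group p \<times>\<times> integer_mod_group p"

lemma group_zmod_square: "group (zmod_square p)"
  by (simp add: zmod_square_def DirProd_group)

lemma carrier_zmod_square:
  "0 < p \<Longrightarrow> carrier (zmod_square p) = {0..<int p} \<times> {0..<int p}"
  by (simp add: zmod_square_def carrier_integer_mod_group)

lemma mult_zmod_square:
  "(a, b) \<otimes>\<^bsub>zmod_square p\<^esub> (c, d) = ((a + c) mod int p, (b + d) mod int p)"
  by (simp add: zmod_square_def)

lemma one_zmod_square: "\<one>\<^bsub>zmod_square p\<^esub> = (0, 0)"
  by (simp add: zmod_square_def)

lemma pow_zmod_square:
  "(a, b) [^]\<^bsub>zmod_square p\<^esub> (n::nat) = (int n * a mod int p, int n * b mod int p)"
proof (induction n)
  case 0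
  then show ?case by (simp add: one_zmod_square nat_pow_def)
next
  case (Suc n)
  interpret group "zmod_square p" by (rule group_zmod_square)
  show ?case
    by (simp add: Suc mult_zmod_square) (simp add: mod_simps algebra_simps)
qed

lemma ord_zmod_square:
  assumes "Factorial_Ring.prime (p::nat)" "c \<in> carrier (zmod_square p)" "c \<noteq> (0, 0)"
  shows "group.ord (zmod_square p) c = p"
proof -
  interpret group "zmod_square p" by (rule group_zmod_square)
  have "c [^]\<^bsub>zmod_square p\<^esub> p = \<one>\<^bsub>zmod_square p\<^esub>"
    by (cases c) (simp add: pow_zmod_square one_zmod_square)
  then have "ord c dvd p"
    using assms(2) by (simp add: pow_eq_id)
  moreover have "ord c \<noteq> 1"
    using ord_eq_1[OF assms(2)] assms(3) by (simp add: one_zmod_square)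
  ultimately show ?thesis
    using assms(1) by (auto simp: prime_nat_iff)
qed

lemma generating_system_zmod_square:
  assumes p: "Factorial_Ring.prime (p::nat)"
    and c: "{(a, b), (c, d), (e, f)} \<subseteq> carrier (zmod_square p)"
    and det: "\<not> int p dvd a * d - b * c"
    and sum: "int p dvd a + c + e" "int p dvd b + d + f"
  shows "generating_system (zmod_square p) ((a, b), (c, d), (e, f))"
proof -
  interpret group "zmod_square p" by (rule group_zmod_square)
  let ?H = "generate (zmod_square p) {(a, b), (c, d), (e, f)}"
  have p0: "0 < p" using p prime_gt_0_nat by blast
  have "coprime (a * d - b * c) (int p)"
    using p det by (simp add: coprime_commute prime_imp_coprime)
  then obtain k where k: "[(a * d - b * c) * k = 1] (mod int p)"
    using cong_solve_coprime_int by blast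
  have H: "subgroup ?H (zmod_square p)"
    using c by (intro generate_is_subgroup) auto
  have mem: "(x, y) \<in> ?H" if xy: "(x, y) \<in> carrier (zmod_square p)" for x y
  proof -
    define s where "s = nat ((x * d - y * c) * k mod int p)"
    define t where "t = nat ((y * a - x * b) * k mod int p)"
    have s: "int s = (x * d - y * c) * k mod int p" and t: "int t = (y * a - x * b) * k mod int p"
      using p0 by (simp_all add: s_def t_def)
    have pow: "v [^]\<^bsub>zmod_square p\<^esub> (n::nat) \<in> ?H" if "v \<in> {(a, b), (c, d), (e, f)}" for v n
      using subgroup_int_pow_closed[OF H generate.incl[OF that], of "int n"] by (simp add: int_pow_int)
    have "(a, b) [^]\<^bsub>zmod_square p\<^esub> s \<otimes>\<^bsub>zmod_square p\<^esub> (c, d) [^]\<^bsub>zmod_square p\<^esub> t \<in> ?H"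
      by (intro subgroup.m_closed[OF H] pow) auto
    moreover have "[int s * a + int t * c = x * ((a * d - b * c) * k)] (mod int p)"
    proof -
      have "[int s * a + int t * c = (x * d - y * c) * k * a + (y * a - x * b) * k * c] (mod int p)"
        unfolding s t by (intro cong_add cong_mult) (simp_all add: cong_def)
      then show ?thesis by (simp add: algebra_simps)
    qed
    then have "[int s * a + int t * c = x] (mod int p)"
      using cong_trans cong_scalar_left[OF k, of x] by fastforce
    moreover have "[int s * b + int t * d = y * ((a * d - b * c) * k)] (mod int p)"
    proof -
      have "[int s * b + int t * d = (x * d - y * c) * k * b + (y * a - x * b) * k * d] (mod int p)"
        unfolding s t by (intro cong_add cong_mult) (simp_all add: cong_def)
      then show ?thesis by (simp add: algebra_simps)
    qed
    then have "[int s * b + int t * d = y] (mod int p)"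
      using cong_trans cong_scalar_left[OF k, of y] by fastforce
    ultimately show ?thesis
      using xy by (simp add: pow_zmod_square mult_zmod_square carrier_zmod_square[OF p0] cong_def mod_simps)
  qed
  have "?H \<subseteq> carrier (zmod_square p)"
    using H subgroup.subset by blast
  with mem c sum show ?thesis
    by (auto simp: mult_zmod_square one_zmod_square mod_simps)
qed

lemma stabilizer_set_zmod_square:
  assumes "c1 \<in> carrier (zmod_square p)" "c2 \<in> carrier (zmod_square p)"
    "c3 \<in> carrier (zmod_square p)"
  shows "stabilizer_set (zmod_square p) (c1, c2, c3) =
    {c [^]\<^bsub>zmod_square p\<^esub> (j::nat) | c j. c \<in> {c1, c2, c3}}"
proof -
  interpret comm_group "zmod_square p"
    by (rule group.group_comm_groupI[OF group_zmod_square])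
       (auto simp: mult_zmod_square add.commute)
  have conj: "g \<otimes>\<^bsub>zmod_square p\<^esub> c [^]\<^bsub>zmod_square p\<^esub> j \<otimes>\<^bsub>zmod_square p\<^esub> inv\<^bsub>zmod_square p\<^esub> g
      = c [^]\<^bsub>zmod_square p\<^esub> j"
    if "g \<in> carrier (zmod_square p)" "c \<in> {c1, c2, c3}" for g c and j :: nat
  proof -
    have "c \<in> carrier (zmod_square p)" using that(2) assms by blast
    with that(1) show ?thesis by (simp add: m_comm[of g] m_assoc)
  qed
  have "stabilizer_set (zmod_square p) (c1, c2, c3) =
      (\<Union>g\<in>carrier (zmod_square p). \<Union>j::nat. \<Union>c\<in>{c1, c2, c3}. {c [^]\<^bsub>zmod_square p\<^esub> j})"
    unfolding stabilizer_set.simps by (intro SUP_cong refl) (simp only: conj)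
  also have "\<dots> = {c [^]\<^bsub>zmod_square p\<^esub> (j::nat) | c j. c \<in> {c1, c2, c3}}"
    using one_closed by blast
  finally show ?thesis .
qed

text \<open>
  Beauville surfaces with group \<open>(\<int>/p\<int>)\<^sup>2\<close> and type \<open>((p, p, p), (p, p, p))\<close> exist for all primes
  \<open>p \<ge> 5\<close>: the two systems consist of vectors spanning the lines of slopes
  \<open>0, \<infinity>, 1\<close> and \<open>-1, 2, 1/2\<close>.
\<close>

lemma ex_beauville_structure_zmod_square:
  assumes p: "Factorial_Ring.prime (p::nat)" "5 \<le> p"
  shows "\<exists>V. beauville_structure (zmod_square p) (p, p, p) (p, p, p) V"
proof -
  define P where "P = int p"
  let ?G = "zmod_square p"
  let ?V1 = "((1, 0), (0, 1), (P - 1, P - 1)) :: (int \<times> int) triple"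
  let ?V2 = "((1, P - 1), (1, 2), (P - 2, P - 1)) :: (int \<times> int) triple"
  have P: "5 \<le> P" and pP: "int p = P" using p by (simp_all add: P_def)
  have p0: "0 < p" using p by simp
  have nd: "\<not> P dvd x" if "x = r + P * k" "r \<in> {-3, -2, -1, 1, 2, 3}" for x r k
  proof -
    have "\<not> P dvd r"
      using that(2) P zdvd_not_zless[of 1 P] zdvd_not_zless[of 2 P] zdvd_not_zless[of 3 P] by auto
    then show ?thesis using that(1) by (simp add: dvd_add_left_iff)
  qed
  have carr: "v \<in> carrier ?G"
    if "v \<in> {(1, 0), (0, 1), (P - 1, P - 1), (1, P - 1), (1, 2), (P - 2, P - 1)}" for v
    using that P by (auto simp: carrier_zmod_square[OF p0] pP)
  have ord: "group.ord ?G v = p"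
    if "v \<in> {(1, 0), (0, 1), (P - 1, P - 1), (1, P - 1), (1, 2), (P - 2, P - 1)}" for v
    using that P by (intro ord_zmod_square[OF p(1) carr]) auto
  have gen1: "generating_system ?G ?V1"
    using P nd[of 1 1 0]
    by (intro generating_system_zmod_square[OF p(1)]) (use carr in \<open>auto simp: pP\<close>)
  have gen2: "generating_system ?G ?V2"
    using P nd[of "1 * 2 - (P - 1) * 1" 3 "-1"]
    by (intro generating_system_zmod_square[OF p(1)]) (use carr in \<open>auto simp: pP\<close>)
  have indep: "(a, b) [^]\<^bsub>?G\<^esub> i = \<one>\<^bsub>?G\<^esub>"
    if eq: "(a, b) [^]\<^bsub>?G\<^esub> i = (c, d) [^]\<^bsub>?G\<^esub> j" and det: "\<not> P dvd a * d - b * c"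
    for a b c d :: int and i j :: nat
  proof -
    have 1: "P dvd int i * a - int j * c" "P dvd int i * b - int j * d"
      using eq by (simp_all add: pow_zmod_square pP mod_eq_dvd_iff)
    have "P dvd (int i * a - int j * c) * d - (int i * b - int j * d) * c"
      by (rule dvd_diff[OF dvd_mult2[OF 1(1)] dvd_mult2[OF 1(2)]])
    also have "\<dots> = int i * (a * d - b * c)" by (simp add: algebra_simps)
    finally have "P dvd int i"
      using det p(1) by (metis P_def prime_dvd_multD prime_nat_int_transfer)
    then show ?thesis by (simp add: pow_zmod_square one_zmod_square pP)
  qed
  have det: "\<not> P dvd fst v * snd w - snd v * fst w"
    if "v \<in> {(1, 0), (0, 1), (P - 1, P - 1)}" "w \<in> {(1, P - 1), (1, 2), (P - 2, P - 1)}" for v w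
  proof -
    have "\<not> P dvd P - 1" by (rule nd[of _ "-1" 1]) simp_all
    moreover have "\<not> P dvd 2" by (rule nd[of _ 2 0]) simp_all
    moreover have "\<not> P dvd 2 - P" by (rule nd[of _ 2 "-1"]) simp_all
    moreover have "\<not> P dvd P * P + 2 - P * 3"
      by (rule nd[of _ 2 "P - 3"]) (simp_all add: algebra_simps)
    ultimately show ?thesis
      using that P by (auto simp: algebra_simps)
  qed
  have "x = \<one>\<^bsub>?G\<^esub>" if x: "x \<in> stabilizer_set ?G ?V1" "x \<in> stabilizer_set ?G ?V2" for x
  proof -
    have st: "stabilizer_set ?G ?V1 =
        {c [^]\<^bsub>?G\<^esub> (j::nat) | c j. c \<in> {(1, 0), (0, 1), (P - 1, P - 1)}}"
      "stabilizer_set ?G ?V2 =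
        {c [^]\<^bsub>?G\<^esub> (j::nat) | c j. c \<in> {(1, P - 1), (1, 2), (P - 2, P - 1)}}"
      by (intro stabilizer_set_zmod_square carr; blast)+
    obtain v i w j where v: "v \<in> {(1, 0), (0, 1), (P - 1, P - 1)}" "x = v [^]\<^bsub>?G\<^esub> (i::nat)"
      and w: "w \<in> {(1, P - 1), (1, 2), (P - 2, P - 1)}" "x = w [^]\<^bsub>?G\<^esub> (j::nat)"
      using x unfolding st by blast
    show ?thesis
      using indep[of "fst v" "snd v" i "fst w" "snd w" j] det[OF v(1) w(1)] v(2) w(2) by simp
  qed
  moreover have "\<one>\<^bsub>?G\<^esub> \<in> stabilizer_set ?G V" if "generating_system ?G V" for V
  proof -
    interpret group ?G by (rule group_zmod_square)
    obtain c1 c2 c3 where V: "V = (c1, c2, c3)" by (cases V)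
    have "\<one>\<^bsub>?G\<^esub> = c1 [^]\<^bsub>?G\<^esub> (0::nat)" by simp
    moreover have "stabilizer_set ?G V = {c [^]\<^bsub>?G\<^esub> (j::nat) | c j. c \<in> {c1, c2, c3}}"
      unfolding V by (rule stabilizer_set_zmod_square) (use that V in auto)
    ultimately show ?thesis by blast
  qed
  ultimately have disj: "disjoint_systems ?G ?V1 ?V2"
    unfolding disjoint_systems_def using gen1 gen2 by blast
  have "order ?G = p ^ 2"
    by (simp add: order_def carrier_zmod_square[OF p0] card_cartesian_product power2_eq_square)
  then have genus: "cover_genus ?G (p, p, p) = real p * (real p - 3) / 2 + 1"
    using p0 by (simp add: field_simps power2_eq_square)
  have "even (P * (P - 3))" by auto
  then obtain k where "P * (P - 3) = 2 * k" by (elim evenE)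
  then have "real_of_int (P * (P - 3)) = real_of_int (2 * k)" by (rule arg_cong)
  then have "real p * (real p - 3) / 2 = of_int k" by (simp add: P_def)
  then have int: "cover_genus ?G (p, p, p) \<in> \<int>"
    unfolding genus by simp
  have "5 * 2 \<le> real p * (real p - 3)"
    using p(2) by (intro mult_mono) auto
  then have ge2: "2 \<le> cover_genus ?G (p, p, p)"
    unfolding genus by simp
  show ?thesis
    using gen1 gen2 disj int ge2 ord
    by (intro exI[of _ "(?V1, ?V2)"]) (simp add: of_type_def del: generating_system.simps cover_genus.simps)
qed

end

theory Submission
  imports Defs
begin

text \<open>
  In an abelian group the braid generators merely permute the entries of a triple, so the braid
  action contributes at most six triples to an orbit and the count is governed by the automorphism
  group. Fix a system of generators \<open>E\<close> and let \<open>N\<close> be the number of systems \<open>W\<close> for which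
  \<open>(E, W)\<close> is a disjoint pair.

  Lower bound. An automorphism is determined by what it does to a triple that it sends to the
  generating triple \<open>E\<close>. Hence a point \<open>(E, W)\<close> of the orbit of \<open>(T1, T2)\<close> is determined by the choice
  of one of the two orders of \<open>T1\<close> and \<open>T2\<close> and of a permutation of each of them: every orbit contains at
  most \<open>2 \<cdot> 6 \<cdot> 6 = 72\<close> such points, and \<open>N \<le> 72 h\<close>
  (\<open>card_disjoint_from_le_hurwitz_number\<close>).

  Upper bound. If the automorphism group moves \<open>E\<close> to every system of generators, each orbit contains
  some \<open>(E, W)\<close>, and \<open>W\<close> is determined by its first two entries, so \<open>h \<le> |G|\<^sup>2\<close>
  (\<open>hurwitz_number_le\<close>).

  For \<open>G = (\<int>/p\<int>)\<^sup>2\<close> take \<open>E\<close> to be the standard basis completed by minus its sum. Transitivity holds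
  because the homomorphism with prescribed values on the basis is onto when these values generate. A
  system \<open>W\<close> is a \<open>2 \<times> 2\<close> matrix over \<open>\<int>/p\<int>\<close>, and disjointness from \<open>E\<close> says that its vectors lie on none of
  the three lines of slopes \<open>0\<close>, \<open>\<infinity>\<close> and \<open>1\<close>; choosing the four entries one after another, each has at
  most five forbidden values, so \<open>(p - 5)\<^sup>4 \<le> N\<close> (\<open>card_disjoint_from_standard_system\<close>). Thus \<open>h\<close> has
  order \<open>p\<^sup>4\<close>, as has \<open>\<chi>\<^sup>2 = (p - 3)\<^sup>4 / 16\<close>.
\<close>

section \<open>The braid action on triples in a group\<close>

lemma map_triple_in_triples:
  assumes "\<phi> \<in> hom G H" "T \<in> triples G"
  shows "map_triple \<phi> T \<in> triples H"
  using assms by (auto simp: map_triple_def hom_def)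

lemma braid_map_triple:
  assumes "group G" "\<phi> \<in> hom G G" "T \<in> triples G"
  shows "braid1 G (map_triple \<phi> T) = map_triple \<phi> (braid1 G T)"
    and "braid2 G (map_triple \<phi> T) = map_triple \<phi> (braid2 G T)"
proof -
  interpret group_hom G G \<phi>
    using assms by (simp add: group_hom_def group_hom_axioms_def)
  show "braid1 G (map_triple \<phi> T) = map_triple \<phi> (braid1 G T)"
    and "braid2 G (map_triple \<phi> T) = map_triple \<phi> (braid2 G T)"
    using assms(3) by (auto simp: map_triple_def braid1_def braid2_def)
qed

lemma braid_perms_Bij:
  assumes "group G" "\<gamma> \<in> braid_perms G"
  shows "\<gamma> \<in> Bij (triples G)"
proof -
  have "generate (BijGroup (triples G)) {braid1 G, braid2 G} \<subseteq> carrier (BijGroup (triples G))"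
    using braid_in_Bij[OF assms(1)]
    by (intro group.generate_incl group_BijGroup) (simp add: BijGroup_def)
  then show ?thesis
    using assms(2) by (auto simp: braid_perms_def BijGroup_def)
qed

lemma braid_perms_in_triples:
  assumes "group G" "\<gamma> \<in> braid_perms G" "T \<in> triples G"
  shows "\<gamma> T \<in> triples G"
  using Bij_imp_funcset[OF braid_perms_Bij[OF assms(1,2)]] assms(3) by blast

lemma id_in_braid_perms: "(\<lambda>T\<in>triples G. T) \<in> braid_perms G"
  using generate.one[of "BijGroup (triples G)"] by (simp add: braid_perms_def BijGroup_def)

text \<open>
  Braids act by words in the entries of a triple, so they commute with every endomorphism. The case
  of an inverse generator uses that it inverts a bijection commuting with the endomorphism.
\<close>

lemma braid_perms_map_triple:
  assumes G: "group G" and \<phi>: "\<phi> \<in> hom G G" and "\<gamma> \<in> braid_perms G" "T \<in> triples G"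
  shows "\<gamma> (map_triple \<phi> T) = map_triple \<phi> (\<gamma> T)"
  using assms(3,4) unfolding braid_perms_def
proof (induction arbitrary: T rule: generate.induct)
  case one
  then show ?case
    using map_triple_in_triples[OF \<phi>] by (simp add: BijGroup_def)
next
  case (incl h)
  then show ?case using braid_map_triple[OF G \<phi>] by blast
next
  case (inv h)
  have h: "h \<in> Bij (triples G)" using inv.hyps braid_in_Bij[OF G] by blast
  then have bij: "bij_betw h (triples G) (triples G)" by (simp add: Bij_def)
  define U where "U = inv_into (triples G) h T"
  have U: "U \<in> triples G" "h U = T"
    using inv.prems bij unfolding U_def
    by (simp_all only: bij_betw_inv_into_right bij_betw_apply[OF bij_betw_inv_into])
  have "h (map_triple \<phi> U) = map_triple \<phi> (h U)"
    using inv.hyps braid_map_triple[OF G \<phi> U(1)] by blast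
  then have "inv_into (triples G) h (map_triple \<phi> T) = map_triple \<phi> U"
    using U bij_betw_inv_into_left[OF bij map_triple_in_triples[OF \<phi> U(1)]] by simp
  then show ?case
    using inv.prems map_triple_in_triples[OF \<phi> inv.prems]
    by (simp add: inv_BijGroup[OF h] U_def)
next
  case (eng h1 h2)
  have "h1 \<in> Bij (triples G)" "h2 \<in> Bij (triples G)"
    using eng.hyps braid_perms_Bij[OF G] by (simp_all add: braid_perms_def)
  moreover have "h2 T \<in> triples G"
    using eng.hyps(2) eng.prems braid_perms_in_triples[OF G] by (simp add: braid_perms_def)
  ultimately show ?case
    using eng.IH eng.prems map_triple_in_triples[OF \<phi> eng.prems]
    by (simp add: BijGroup_def compose_eq)
qed

text \<open>
  Conjugation is trivial in an abelian group, so the two generators are transpositions of adjacent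
  entries. An orbit of the braid group thus has at most six elements.
\<close>

lemma braid_perms_mset_triple:
  assumes G: "comm_group G" and "\<gamma> \<in> braid_perms G" "T \<in> triples G"
  shows "mset_triple (\<gamma> T) = mset_triple T"
proof -
  interpret comm_group G by fact
  have braid: "mset_triple (h T) = mset_triple T"
    if "h \<in> {braid1 G, braid2 G}" "T \<in> triples G" for h T
  proof -
    have "inv\<^bsub>G\<^esub> x \<otimes>\<^bsub>G\<^esub> y \<otimes>\<^bsub>G\<^esub> x = y" if "x \<in> carrier G" "y \<in> carrier G" for x y
      using that by (simp add: m_comm[of "inv\<^bsub>G\<^esub> x"] m_assoc)
    then show ?thesis
      using that by (auto simp: braid1_def braid2_def add_mset_commute)
  qed
  show ?thesis
    using assms(2,3) unfolding braid_perms_def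
  proof (induction arbitrary: T rule: generate.induct)
    case one
    then show ?case by (simp add: BijGroup_def)
  next
    case (incl h)
    then show ?case using braid by blast
  next
    case (inv h)
    have h: "h \<in> Bij (triples G)" using inv.hyps braid_in_Bij[OF is_group] by blast
    then have bij: "bij_betw h (triples G) (triples G)" by (simp add: Bij_def)
    let ?U = "inv_into (triples G) h T"
    have "h ?U = T" "?U \<in> triples G"
      using inv.prems bij by (simp_all only: bij_betw_inv_into_right bij_betw_apply[OF bij_betw_inv_into])
    then show ?case
      using braid[OF inv.hyps, of ?U] inv.prems by (simp add: inv_BijGroup[OF h])
  next
    case (eng h1 h2)
    have "h1 \<in> Bij (triples G)" "h2 \<in> Bij (triples G)"
      using eng.hyps braid_perms_Bij[OF is_group] by (simp_all add: braid_perms_def)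
    moreover have "h2 T \<in> triples G"
      using eng.hyps(2) eng.prems braid_perms_in_triples[OF is_group] by (simp add: braid_perms_def)
    ultimately show ?case
      using eng.IH eng.prems by (simp add: BijGroup_def compose_eq)
  qed
qed

section \<open>Counting Hurwitz components\<close>

lemma hurwitz_orbitE:
  assumes "Q \<in> hurwitz_orbit G P"
  obtains \<phi> \<gamma>1 \<gamma>2 T1 T2 where "\<phi> \<in> iso G G" "\<gamma>1 \<in> braid_perms G" "\<gamma>2 \<in> braid_perms G"
    "(T1, T2) \<in> {P, prod.swap P}" "Q = (map_triple \<phi> (\<gamma>1 T1), map_triple \<phi> (\<gamma>2 T2))"
  using assms unfolding hurwitz_orbit_def by blast

lemma hurwitz_orbit_refl:
  assumes "T1 \<in> triples G" "T2 \<in> triples G"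
  shows "(T1, T2) \<in> hurwitz_orbit G (T1, T2)"
proof -
  have "(\<lambda>x. x) \<in> iso G G" using iso_refl by (auto simp: is_iso_def iso_def hom_def bij_betw_def)
  then show ?thesis
    unfolding hurwitz_orbit_def
    using assms id_in_braid_perms[of G]
    by (intro CollectI exI[of _ "\<lambda>x. x"] exI[of _ "\<lambda>T\<in>triples G. T"] exI[of _ T1] exI[of _ T2])
       (auto simp: map_triple_def prod.map_id0 prod.map_ident)
qed

lemma map_triple_comp: "map_triple f (map_triple g T) = map_triple (f \<circ> g) T"
  by (cases T) (simp add: map_triple_def)

lemma map_triple_cong:
  assumes "T \<in> triples G" "\<And>x. x \<in> carrier G \<Longrightarrow> f x = g x"
  shows "map_triple f T = map_triple g T"
  using assms by (cases T) (auto simp: map_triple_def)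

lemma hurwitz_orbit_map_triple_subset:
  assumes G: "group G" and \<phi>: "\<phi> \<in> iso G G" and T: "T1 \<in> triples G" "T2 \<in> triples G"
  shows "hurwitz_orbit G (map_triple \<phi> T1, map_triple \<phi> T2) \<subseteq> hurwitz_orbit G (T1, T2)"
proof
  fix Q assume Q: "Q \<in> hurwitz_orbit G (map_triple \<phi> T1, map_triple \<phi> T2)"
  obtain \<psi> \<gamma>1 \<gamma>2 U1 U2 where *: "\<psi> \<in> iso G G" "\<gamma>1 \<in> braid_perms G" "\<gamma>2 \<in> braid_perms G"
      "(U1, U2) \<in> {(T1, T2), prod.swap (T1, T2)}"
      "Q = (map_triple \<psi> (\<gamma>1 (map_triple \<phi> U1)), map_triple \<psi> (\<gamma>2 (map_triple \<phi> U2)))"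
    using Q by (elim hurwitz_orbitE) (simp, elim disjE conjE; blast)
  have hom: "\<phi> \<in> hom G G" using \<phi> by (simp add: iso_def)
  have U: "U1 \<in> triples G" "U2 \<in> triples G" using *(4) T by auto
  have "Q = (map_triple (\<psi> \<circ> \<phi>) (\<gamma>1 U1), map_triple (\<psi> \<circ> \<phi>) (\<gamma>2 U2))"
    unfolding *(5) using braid_perms_map_triple[OF G hom *(2) U(1)] braid_perms_map_triple[OF G hom *(3) U(2)]
    by (simp add: map_triple_comp)
  moreover have "\<psi> \<circ> \<phi> \<in> iso G G" using iso_set_trans[OF \<phi> *(1)] by (simp add: compose_def)
  ultimately show "Q \<in> hurwitz_orbit G (T1, T2)"
    using * unfolding hurwitz_orbit_def by blast
qed

text \<open>
  Since the braid action commutes with automorphisms, both components may be moved by a common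
  automorphism without changing the orbit. This normalises the first component in the upper bound.
\<close>

lemma hurwitz_orbit_map_triple:
  assumes G: "group G" and \<phi>: "\<phi> \<in> iso G G" and T: "T1 \<in> triples G" "T2 \<in> triples G"
  shows "hurwitz_orbit G (map_triple \<phi> T1, map_triple \<phi> T2) = hurwitz_orbit G (T1, T2)"
proof
  show "hurwitz_orbit G (map_triple \<phi> T1, map_triple \<phi> T2) \<subseteq> hurwitz_orbit G (T1, T2)"
    by (rule hurwitz_orbit_map_triple_subset[OF assms])
  let ?\<psi> = "inv_into (carrier G) \<phi>"
  have \<psi>: "?\<psi> \<in> iso G G" using group.iso_set_sym[OF G \<phi>] .
  have hom: "\<phi> \<in> hom G G" using \<phi> by (simp add: iso_def)
  have "map_triple ?\<psi> (map_triple \<phi> T) = T" if "T \<in> triples G" for T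
    using \<phi> that by (auto simp: map_triple_def iso_def bij_betw_inv_into_left)
  then show "hurwitz_orbit G (T1, T2) \<subseteq> hurwitz_orbit G (map_triple \<phi> T1, map_triple \<phi> T2)"
    using hurwitz_orbit_map_triple_subset[OF G \<psi>, of "map_triple \<phi> T1" "map_triple \<phi> T2"]
      map_triple_in_triples[OF hom] T by simp
qed

lemma hom_eq_on_generate:
  assumes G: "group G" and f: "f \<in> hom G H" and g: "g \<in> hom G H" and H: "group H"
    and A: "A \<subseteq> carrier G" "\<And>x. x \<in> A \<Longrightarrow> f x = g x" and x: "x \<in> generate G A"
  shows "f x = g x"
proof -
  interpret f: group_hom G H f using G H f by (simp add: group_hom_def group_hom_axioms_def)
  interpret g: group_hom G H g using G H g by (simp add: group_hom_def group_hom_axioms_def)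
  show ?thesis using x
  proof induction
    case (eng h1 h2)
    then have "h1 \<in> carrier G" "h2 \<in> carrier G"
      using group.generate_incl[OF G A(1)] by auto
    with eng show ?case by simp
  qed (use A in \<open>auto simp: subset_iff\<close>)
qed

lemma generating_system_in_triples: "generating_system G T \<Longrightarrow> T \<in> triples G"
  by (cases T) auto

text \<open>
  It is the target \<open>E\<close> that is assumed to generate, so the comparison is made for the inverses of
  \<open>\<phi>\<close> and \<open>\<psi>\<close>: they agree on the entries of \<open>E\<close>, hence everywhere.
\<close>

lemma iso_unique_to_generating_system:
  assumes G: "group G" and E: "generating_system G E" and A: "A \<in> triples G" and B: "B \<in> triples G"
    and \<phi>: "\<phi> \<in> iso G G" "map_triple \<phi> A = E" and \<psi>: "\<psi> \<in> iso G G" "map_triple \<psi> A = E"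
  shows "map_triple \<phi> B = map_triple \<psi> B"
proof -
  let ?\<phi>' = "inv_into (carrier G) \<phi>" and ?\<psi>' = "inv_into (carrier G) \<psi>"
  have iso: "?\<phi>' \<in> iso G G" "?\<psi>' \<in> iso G G"
    using group.iso_set_sym[OF G] \<phi>(1) \<psi>(1) by blast+
  obtain e1 e2 e3 a1 a2 a3 where e: "E = (e1, e2, e3)" and a: "A = (a1, a2, a3)"
    by (cases E, cases A)
  have agree: "?\<phi>' x = ?\<psi>' x" if "x \<in> {e1, e2, e3}" for x
  proof -
    have "\<exists>y\<in>{a1, a2, a3}. \<phi> y = x \<and> \<psi> y = x"
      using that \<phi>(2) \<psi>(2) by (auto simp: map_triple_def e a)
    then obtain y where "y \<in> carrier G" "\<phi> y = x" "\<psi> y = x"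
      using A by (auto simp: a)
    moreover have "inj_on \<phi> (carrier G)" "inj_on \<psi> (carrier G)"
      using \<phi>(1) \<psi>(1) by (simp_all add: iso_def bij_betw_def)
    ultimately show ?thesis
      using inv_into_f_f[of \<phi> "carrier G" y] inv_into_f_f[of \<psi> "carrier G" y] by simp
  qed
  have inv_eq: "?\<phi>' x = ?\<psi>' x" if "x \<in> carrier G" for x
  proof (rule hom_eq_on_generate[OF G _ _ G, where f = ?\<phi>' and g = ?\<psi>' and A = "{e1, e2, e3}"])
    show "?\<phi>' \<in> hom G G" "?\<psi>' \<in> hom G G" using iso by (simp_all add: iso_def)
    show "{e1, e2, e3} \<subseteq> carrier G" "x \<in> generate G {e1, e2, e3}"
      using E that by (simp_all add: e)
  qed (fact agree)
  have "\<phi> y = \<psi> y" if y: "y \<in> carrier G" for y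
  proof -
    have "\<phi> y \<in> carrier G" using \<phi>(1) y by (auto simp: iso_def hom_def)
    have "?\<phi>' (\<phi> y) = y"
      using y \<phi>(1) by (auto simp: iso_def bij_betw_inv_into_left)
    then have "\<psi> y = \<psi> (?\<psi>' (\<phi> y))" using inv_eq[OF \<open>\<phi> y \<in> carrier G\<close>] by simp
    also have "\<dots> = \<phi> y"
      using \<open>\<phi> y \<in> carrier G\<close> \<psi>(1) by (auto simp: iso_def intro: bij_betw_inv_into_right)
    finally show ?thesis by simp
  qed
  then show ?thesis using map_triple_cong[OF B] by blast
qed

lemma card_mset_triple_eq:
  "finite {U. mset_triple U = mset_triple T}" "card {U. mset_triple U = mset_triple T} \<le> 6"
proof -
  obtain x y z where T: "T = (x, y, z)" by (cases T)
  let ?L = "[(x, y, z), (x, z, y), (y, x, z), (y, z, x), (z, x, y), (z, y, x)]"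
  have sub: "{U. mset_triple U = mset_triple T} \<subseteq> set ?L"
    by (auto simp: T add_eq_conv_ex)
  then show "finite {U. mset_triple U = mset_triple T}" by (rule finite_subset) simp
  have "card {U. mset_triple U = mset_triple T} \<le> card (set ?L)"
    using sub by (intro card_mono) auto
  also have "\<dots> \<le> 6" using card_length[of ?L] by simp
  finally show "card {U. mset_triple U = mset_triple T} \<le> 6" .
qed

text \<open>
  A member of the orbit of \<open>P\<close> arises from one of two orders of \<open>P\<close>, a permutation of each of its two
  triples, and an automorphism; prescribing \<open>E\<close> as first component leaves no freedom for the
  automorphism. This gives \<open>2 \<cdot> 6 \<cdot> 6\<close>.
\<close>

lemma card_hurwitz_orbit_fibre:
  assumes G: "comm_group G" and E: "generating_system G E" and P: "P \<in> triples G \<times> triples G"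
  shows "card {W. (E, W) \<in> hurwitz_orbit G P} \<le> 72"
proof -
  have grp: "group G" using G by (rule comm_group.axioms)
  define R where "R = (\<lambda>T. {U. mset_triple U = mset_triple T} :: 'a triple set)"
  have R: "finite (R T)" "card (R T) \<le> 6" for T
    using card_mset_triple_eq[of T] by (simp_all add: R_def)
  define I where "I = (\<Union>(T1, T2)\<in>{P, prod.swap P}. R T1 \<times> R T2)"
  \<comment> \<open>The second component, as a function of the permuted triples \<open>A\<close> and \<open>B\<close>.\<close>
  define f where "f = (\<lambda>(A, B). SOME W. \<exists>\<phi>\<in>iso G G. map_triple \<phi> A = E \<and> map_triple \<phi> B = W)"
  have sub: "{W. (E, W) \<in> hurwitz_orbit G P} \<subseteq> f ` I"
  proof (rule subsetI)
    fix W assume "W \<in> {W. (E, W) \<in> hurwitz_orbit G P}"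
    then have W: "(E, W) \<in> hurwitz_orbit G P" by simp
    obtain \<phi> \<gamma>1 \<gamma>2 T1 T2 where *: "\<phi> \<in> iso G G" "\<gamma>1 \<in> braid_perms G" "\<gamma>2 \<in> braid_perms G"
      "(T1, T2) \<in> {P, prod.swap P}" "E = map_triple \<phi> (\<gamma>1 T1)" "W = map_triple \<phi> (\<gamma>2 T2)"
      using W by (elim hurwitz_orbitE) blast
    have T: "T1 \<in> triples G" "T2 \<in> triples G" using *(4) P by auto
    have \<gamma>T: "\<gamma>1 T1 \<in> triples G" "\<gamma>2 T2 \<in> triples G"
      using braid_perms_in_triples[OF grp] * T by blast+
    have "f (\<gamma>1 T1, \<gamma>2 T2) = W"
      unfolding f_def prod.case
    proof (rule some_equality)
      show "\<exists>\<phi>\<in>iso G G. map_triple \<phi> (\<gamma>1 T1) = E \<and> map_triple \<phi> (\<gamma>2 T2) = W"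
        using * by blast
    next
      fix W' assume "\<exists>\<phi>\<in>iso G G. map_triple \<phi> (\<gamma>1 T1) = E \<and> map_triple \<phi> (\<gamma>2 T2) = W'"
      then show "W' = W"
        using iso_unique_to_generating_system[OF grp E \<gamma>T] * by metis
    qed
    moreover have "(\<gamma>1 T1, \<gamma>2 T2) \<in> I"
      using *(4) braid_perms_mset_triple[OF G *(2) T(1)] braid_perms_mset_triple[OF G *(3) T(2)]
      by (force simp: I_def R_def)
    ultimately show "W \<in> f ` I" by blast
  qed
  have finI: "finite I" using R by (auto simp: I_def split: prod.splits)
  have "card I \<le> (\<Sum>(T1, T2)\<in>{P, prod.swap P}. card (R T1 \<times> R T2))"
    unfolding I_def by (rule order_trans[OF card_UN_le]) (auto intro!: sum_mono)
  also have "\<dots> \<le> of_nat (card {P, prod.swap P}) * 36"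
    using mult_le_mono[OF R(2) R(2)]
    by (intro sum_bounded_above) (auto simp: card_cartesian_product split: prod.splits)
  also have "\<dots> \<le> 2 * 36" by (intro mult_right_mono) (auto simp: card_insert_if)
  finally have "card I \<le> 72" by simp
  then show ?thesis
    using surj_card_le[OF finI sub] by simp
qed

lemma disjoint_pairs_subset: "disjoint_pairs G \<tau>1 \<tau>2 \<subseteq> triples G \<times> triples G"
  using generating_system_in_triples
  unfolding disjoint_pairs_def of_unordered_type_def by blast

text \<open>
  The orbits cover the pairs with first component \<open>E\<close>, and each contains at most 72 of them.
\<close>

lemma card_disjoint_from_le_hurwitz_number:
  assumes G: "comm_group G" and fin: "finite (carrier G)" and E: "generating_system G E"
  shows "card {W. (E, W) \<in> disjoint_pairs G \<tau> \<tau>} \<le> 72 * hurwitz_number G \<tau>"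
proof -
  let ?U = "disjoint_pairs G \<tau> \<tau>"
  let ?Orb = "hurwitz_orbit G ` ?U"
  define fib where "fib Q = {W. (E, W) \<in> Q}" for Q :: "('a triple \<times> 'a triple) set"
  have finU: "finite ?U"
    by (rule finite_subset[OF disjoint_pairs_subset]) (intro finite_cartesian_product fin)
  have sub: "fib ?U \<subseteq> (\<Union>Q\<in>?Orb. fib Q)"
  proof (rule subsetI)
    fix W assume W: "W \<in> fib ?U"
    then have EW: "(E, W) \<in> ?U" by (simp add: fib_def)
    then have "E \<in> triples G" "W \<in> triples G"
      using subsetD[OF disjoint_pairs_subset, of "(E, W)"] by blast+
    then have "(E, W) \<in> hurwitz_orbit G (E, W)" by (rule hurwitz_orbit_refl)
    with EW show "W \<in> (\<Union>Q\<in>?Orb. fib Q)" by (auto simp: fib_def)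
  qed
  have fib_sub: "fib Q \<subseteq> triples G" if "Q \<in> ?Orb" for Q
  proof (rule subsetI)
    fix W assume "W \<in> fib Q"
    then have "(E, W) \<in> Q" by (simp add: fib_def)
    moreover obtain P where "P \<in> ?U" "Q = hurwitz_orbit G P" using \<open>Q \<in> ?Orb\<close> by (elim imageE)
    ultimately have EW: "(E, W) \<in> hurwitz_orbit G P" and P: "P \<in> triples G \<times> triples G"
      using subsetD[OF disjoint_pairs_subset] by simp_all
    obtain \<phi> \<gamma>2 T1 T2 where "\<phi> \<in> hom G G" "\<gamma>2 \<in> braid_perms G"
      and T: "(T1, T2) \<in> {P, prod.swap P}" and W: "W = map_triple \<phi> (\<gamma>2 T2)"
      using EW by (elim hurwitz_orbitE) (unfold iso_def, blast)
    moreover have "T2 \<in> triples G" using T P by (cases P) auto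
    ultimately show "W \<in> triples G"
      unfolding W using comm_group.axioms(2)[OF G]
      by (intro map_triple_in_triples[OF _ braid_perms_in_triples])
  qed
  have "card (fib ?U) \<le> card (\<Union>Q\<in>?Orb. fib Q)"
  proof (rule card_mono[OF _ sub])
    show "finite (\<Union>Q\<in>?Orb. fib Q)"
    proof (rule finite_UN_I)
      show "finite ?Orb" using finU by (rule finite_imageI)
      show "finite (fib Q)" if "Q \<in> ?Orb" for Q
        by (rule finite_subset[OF fib_sub[OF that]]) (intro finite_cartesian_product fin)
    qed
  qed
  also have "\<dots> \<le> (\<Sum>Q\<in>?Orb. card (fib Q))"
    using finU by (intro card_UN_le) simp
  also have "\<dots> \<le> of_nat (card ?Orb) * 72"
  proof (rule sum_bounded_above)
    fix Q assume "Q \<in> ?Orb"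
    then obtain P where "P \<in> ?U" "Q = hurwitz_orbit G P" by (elim imageE)
    then show "card (fib Q) \<le> 72"
      unfolding fib_def using card_hurwitz_orbit_fibre[OF G E] subsetD[OF disjoint_pairs_subset] by blast
  qed
  finally show ?thesis by (simp add: hurwitz_number_def fib_def)
qed

text \<open>
  Transitivity allows \<open>E\<close> as first component of a representative of every orbit. The second component
  still has product one, so two free entries remain.
\<close>

lemma hurwitz_number_le:
  assumes G: "group G" and fin: "finite (carrier G)" and E: "E \<in> triples G"
    and trans: "\<And>V. of_unordered_type G \<tau> V \<Longrightarrow> \<exists>\<phi>\<in>iso G G. map_triple \<phi> E = V"
  shows "hurwitz_number G \<tau> \<le> (order G)\<^sup>2"
proof -
  interpret group G by fact
  \<comment> \<open>The triple of product one with given first two entries.\<close>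
  define t where "t = (\<lambda>(x, y). (x, y, inv\<^bsub>G\<^esub> (x \<otimes>\<^bsub>G\<^esub> y)))"
  have "hurwitz_orbit G ` disjoint_pairs G \<tau> \<tau> \<subseteq> (\<lambda>xy. hurwitz_orbit G (E, t xy)) ` (carrier G \<times> carrier G)"
  proof clarify
    fix V1 V2 assume V: "(V1, V2) \<in> disjoint_pairs G \<tau> \<tau>"
    obtain \<phi> where \<phi>: "\<phi> \<in> iso G G" "map_triple \<phi> E = V1"
      using V trans[of V1] by (auto simp: disjoint_pairs_def)
    let ?\<psi> = "inv_into (carrier G) \<phi>"
    have \<psi>: "?\<psi> \<in> iso G G" using iso_set_sym[OF \<phi>(1)] .
    interpret \<psi>: group_hom G G ?\<psi>
      using \<psi> by (simp add: group_hom_def group_hom_axioms_def iso_def is_group)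
    obtain x y z where xyz: "V2 = (x, y, z)" by (cases V2)
    have V2: "x \<in> carrier G" "y \<in> carrier G" "z \<in> carrier G" "x \<otimes>\<^bsub>G\<^esub> y \<otimes>\<^bsub>G\<^esub> z = \<one>\<^bsub>G\<^esub>"
      using V by (auto simp: disjoint_pairs_def of_unordered_type_def xyz)
    have "z = inv\<^bsub>G\<^esub> (x \<otimes>\<^bsub>G\<^esub> y)" 
      using V2 by (metis inv_comm m_closed inv_equality)
    then have z: "?\<psi> z = inv\<^bsub>G\<^esub> (?\<psi> x \<otimes>\<^bsub>G\<^esub> ?\<psi> y)" using V2 by simp
    have "map_triple \<phi> (map_triple ?\<psi> V2) = V2"
      using V2 \<phi>(1) by (auto simp: xyz map_triple_def iso_def bij_betw_inv_into_right)
    then have "hurwitz_orbit G (V1, V2) = hurwitz_orbit G (E, map_triple ?\<psi> V2)"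
      using hurwitz_orbit_map_triple[OF G \<phi>(1) E, of "map_triple ?\<psi> V2"] \<phi>(2) V2
      by (simp add: xyz map_triple_def)
    also have "map_triple ?\<psi> V2 = t (?\<psi> x, ?\<psi> y)"
      by (simp add: xyz map_triple_def t_def z)
    finally show "hurwitz_orbit G (V1, V2) \<in> (\<lambda>xy. hurwitz_orbit G (E, t xy)) ` (carrier G \<times> carrier G)"
      using V2 by (intro image_eqI[of _ _ "(?\<psi> x, ?\<psi> y)"]) simp_all
  qed
  from surj_card_le[OF _ this] have "hurwitz_number G \<tau> \<le> card (carrier G \<times> carrier G)"
    using fin by (simp add: hurwitz_number_def)
  then show ?thesis by (simp add: card_cartesian_product order_def power2_eq_square)
qed

section \<open>Counting for \<open>(\<int>/p\<int>)\<^sup>2\<close>\<close>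

lemma comm_group_zmod_square: "comm_group (zmod_square p)"
  by (rule group.group_comm_groupI[OF group_zmod_square]) (auto simp: mult_zmod_square add.commute)

lemma finite_zmod_square: "0 < p \<Longrightarrow> finite (carrier (zmod_square p))"
  by (simp add: carrier_zmod_square)

lemma order_zmod_square: "0 < p \<Longrightarrow> order (zmod_square p) = p\<^sup>2"
  by (simp add: order_def carrier_zmod_square card_cartesian_product power2_eq_square)

text \<open>Representatives in \<open>{0..<p}\<close> are required, so the last entry is \<open>(p - 1, p - 1)\<close>, not \<open>(-1, -1)\<close>.\<close>

definition standard_system :: "nat \<Rightarrow> (int \<times> int) triple" where
  "standard_system p = ((1, 0), (0, 1), (int p - 1, int p - 1))"

lemma generating_standard_system:
  assumes "Factorial_Ring.prime (p::nat)"
  shows "generating_system (zmod_square p) (standard_system p)"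
proof -
  have "1 < p" using assms prime_gt_1_nat by blast
  then have "\<not> int p dvd 1" by simp
  with \<open>1 < p\<close> show ?thesis
    unfolding standard_system_def
    by (intro generating_system_zmod_square[OF assms]) (auto simp: carrier_zmod_square)
qed

text \<open>
  The matrix with rows the first two entries of \<open>V\<close> defines an endomorphism, which sends the third
  entry of the standard system to that of \<open>V\<close> because both triples sum to zero. Its image is a subgroup
  containing the generators \<open>V\<close>, so it is onto and, by finiteness, bijective.
\<close>

lemma iso_from_standard_system:
  assumes p: "1 < (p::nat)" and V: "generating_system (zmod_square p) V"
  shows "\<exists>\<phi>\<in>iso (zmod_square p) (zmod_square p). map_triple \<phi> (standard_system p) = V"
proof -
  let ?G = "zmod_square p"
  interpret group ?G by (rule group_zmod_square)
  obtain a b c d e f where Veq: "V = ((a, b), (c, d), (e, f))" by (cases V) auto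
  have p0: "0 < p" using p by simp
  have carr: "(a, b) \<in> carrier ?G" "(c, d) \<in> carrier ?G" "(e, f) \<in> carrier ?G"
    and gen: "generate ?G {(a, b), (c, d), (e, f)} = carrier ?G"
    and sum: "(a + c + e) mod int p = 0" "(b + d + f) mod int p = 0"
    using V by (auto simp: Veq mult_zmod_square one_zmod_square mod_simps)
  define \<phi> where "\<phi> = (\<lambda>(x, y). ((x * a + y * c) mod int p, (x * b + y * d) mod int p))"
  have hom: "\<phi> \<in> hom ?G ?G"
  proof (rule homI)
    show "\<phi> v \<in> carrier ?G" for v
      using p0 by (simp add: \<phi>_def carrier_zmod_square split: prod.splits)
    show "\<phi> (v \<otimes>\<^bsub>?G\<^esub> w) = \<phi> v \<otimes>\<^bsub>?G\<^esub> \<phi> w" for v w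
    proof -
      obtain x y x' y' where vw: "v = (x, y)" "w = (x', y')" by (cases v, cases w)
      have "((x + x') mod int p * s + (y + y') mod int p * t) mod int p
          = ((x * s + y * t) mod int p + (x' * s + y' * t) mod int p) mod int p" for s t
      proof -
        have "[(x + x') mod int p * s + (y + y') mod int p * t = (x + x') * s + (y + y') * t] (mod int p)"
          by (intro cong_add cong_mult) (simp_all add: cong_def)
        moreover have "(x + x') * s + (y + y') * t = (x * s + y * t) + (x' * s + y' * t)"
          by (simp add: algebra_simps)
        ultimately show ?thesis by (simp only: cong_def mod_add_eq)
      qed
      then show ?thesis
        by (simp only: vw \<phi>_def mult_zmod_square prod.case)
    qed
  qed
  interpret \<phi>: group_hom ?G ?G \<phi>
    using hom by (simp add: group_hom_def group_hom_axioms_def is_group)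
  have "[(int p - 1) * a + (int p - 1) * c = e] (mod int p)"
  proof -
    have "int p dvd int p * (a + c) - (a + c + e)"
      using sum(1) by (intro dvd_diff dvd_triv_left) (simp add: dvd_eq_mod_eq_0)
    also have "\<dots> = (int p - 1) * a + (int p - 1) * c - e"
      by (simp add: algebra_simps)
    finally show ?thesis by (simp only: cong_iff_dvd_diff)
  qed
  moreover have "[(int p - 1) * b + (int p - 1) * d = f] (mod int p)"
  proof -
    have "int p dvd int p * (b + d) - (b + d + f)"
      using sum(2) by (intro dvd_diff dvd_triv_left) (simp add: dvd_eq_mod_eq_0)
    also have "\<dots> = (int p - 1) * b + (int p - 1) * d - f"
      by (simp add: algebra_simps)
    finally show ?thesis by (simp only: cong_iff_dvd_diff)
  qed
  ultimately have map: "map_triple \<phi> (standard_system p) = V"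
    using carr p0 by (simp add: Veq map_triple_def standard_system_def \<phi>_def carrier_zmod_square cong_def)
  have "standard_system p \<in> triples ?G"
    using p by (simp add: standard_system_def carrier_zmod_square)
  with map have "{(a, b), (c, d), (e, f)} \<subseteq> \<phi> ` carrier ?G"
    by (auto simp: Veq map_triple_def standard_system_def intro: rev_image_eqI)
  then have "generate ?G {(a, b), (c, d), (e, f)} \<subseteq> \<phi> ` carrier ?G"
    by (intro generate_subgroup_incl \<phi>.img_is_subgroup)
  moreover have "\<phi> ` carrier ?G \<subseteq> carrier ?G" by auto
  ultimately have surj: "\<phi> ` carrier ?G = carrier ?G" using gen by simp
  then have "inj_on \<phi> (carrier ?G)"
    using finite_zmod_square[OF p0] by (intro eq_card_imp_inj_on) simp_all
  then have "\<phi> \<in> iso ?G ?G" using hom surj by (simp add: iso_def bij_betw_def)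
  with map show ?thesis by blast
qed

text \<open>
  If \<open>i v = j w\<close>, taking the determinant with \<open>w\<close> gives \<open>i det (v, w) = 0\<close>; so linearly independent
  vectors have only the trivial multiple in common.
\<close>

lemma disjoint_systems_zmod_square:
  assumes p: "Factorial_Ring.prime (p::nat)"
    and carr: "{v1, v2, v3, w1, w2, w3} \<subseteq> carrier (zmod_square p)"
    and det: "\<And>v w. v \<in> {v1, v2, v3} \<Longrightarrow> w \<in> {w1, w2, w3} \<Longrightarrow>
      \<not> int p dvd fst v * snd w - snd v * fst w"
  shows "disjoint_systems (zmod_square p) (v1, v2, v3) (w1, w2, w3)"
proof -
  let ?G = "zmod_square p"
  interpret group ?G by (rule group_zmod_square)
  have st: "stabilizer_set ?G (v1, v2, v3) = {c [^]\<^bsub>?G\<^esub> (j::nat) | c j. c \<in> {v1, v2, v3}}"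
    "stabilizer_set ?G (w1, w2, w3) = {c [^]\<^bsub>?G\<^esub> (j::nat) | c j. c \<in> {w1, w2, w3}}"
    using carr by (intro stabilizer_set_zmod_square; simp)+
  have "x = \<one>\<^bsub>?G\<^esub>"
    if x: "x \<in> stabilizer_set ?G (v1, v2, v3)" "x \<in> stabilizer_set ?G (w1, w2, w3)" for x
  proof -
    obtain v w and i j :: nat where v: "v \<in> {v1, v2, v3}" "x = v [^]\<^bsub>?G\<^esub> i"
      and w: "w \<in> {w1, w2, w3}" "x = w [^]\<^bsub>?G\<^esub> j"
      using x unfolding st by blast
    obtain a b c d where ab: "v = (a, b)" and cd: "w = (c, d)" by (cases v, cases w)
    have eq: "int i * a mod int p = int j * c mod int p" "int i * b mod int p = int j * d mod int p"
      using v(2) w(2) by (simp_all add: ab cd pow_zmod_square)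
    then have 1: "int p dvd int i * a - int j * c" "int p dvd int i * b - int j * d"
      by (simp_all add: mod_eq_dvd_iff)
    have "int p dvd (int i * a - int j * c) * d - (int i * b - int j * d) * c"
      by (rule dvd_diff[OF dvd_mult2[OF 1(1)] dvd_mult2[OF 1(2)]])
    also have "\<dots> = int i * (a * d - b * c)" by (simp add: algebra_simps)
    finally have "int p dvd int i"
      using det[OF v(1) w(1)] p by (metis ab cd fst_conv snd_conv prime_dvd_multD prime_nat_int_transfer)
    then show ?thesis by (simp add: v(2) ab pow_zmod_square one_zmod_square)
  qed
  moreover have "\<one>\<^bsub>?G\<^esub> = v1 [^]\<^bsub>?G\<^esub> (0::nat)" "\<one>\<^bsub>?G\<^esub> = w1 [^]\<^bsub>?G\<^esub> (0::nat)" by simp_all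
  then have "\<one>\<^bsub>?G\<^esub> \<in> stabilizer_set ?G (v1, v2, v3)" "\<one>\<^bsub>?G\<^esub> \<in> stabilizer_set ?G (w1, w2, w3)"
    unfolding st by blast+
  ultimately show ?thesis
    unfolding disjoint_systems_def by blast
qed

text \<open>The vectors outside the three lines spanned by the entries of the standard system.\<close>

definition off_axes :: "nat \<Rightarrow> int \<times> int \<Rightarrow> bool" where
  "off_axes p = (\<lambda>(x, y). \<not> int p dvd x \<and> \<not> int p dvd y \<and> \<not> int p dvd y - x)"

text \<open>
  The last entry is minus the sum of the other two, and the three lines are stable under negation, so
  the condition on it can be stated for \<open>(a + c, b + d)\<close>.
\<close>

lemma standard_system_disjoint_pair:
  assumes p: "Factorial_Ring.prime (p::nat)"
    and carr: "{(a, b), (c, d)} \<subseteq> carrier (zmod_square p)"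
    and det: "\<not> int p dvd a * d - b * c"
    and off: "off_axes p (a, b)" "off_axes p (c, d)" "off_axes p (a + c, b + d)"
  shows "(standard_system p, (a, b), (c, d), ((- a - c) mod int p, (- b - d) mod int p))
    \<in> disjoint_pairs (zmod_square p) (p, p, p) (p, p, p)"
proof -
  let ?G = "zmod_square p" and ?e = "(- a - c) mod int p" and ?f = "(- b - d) mod int p"
  have p1: "1 < p" using p prime_gt_1_nat by blast
  have prime: "Factorial_Ring.prime (int p)" using p by simp
  have "off_axes p (?e, ?f)"
  proof -
    have "\<not> int p dvd - a - c" "\<not> int p dvd - b - d"
      using off(3) dvd_minus_iff[of "int p" "a + c"] dvd_minus_iff[of "int p" "b + d"]
      by (simp_all add: off_axes_def algebra_simps)
    moreover have "\<not> int p dvd (- b - d) mod int p - (- a - c) mod int p"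
    proof -
      have "(- b - d) - (- a - c) = - ((b + d) - (a + c))" by simp
      then have "\<not> int p dvd (- b - d) - (- a - c)"
        using off(3) by (simp only: dvd_minus_iff off_axes_def prod.case) simp
      then show ?thesis by (simp add: dvd_eq_mod_eq_0 mod_simps)
    qed
    ultimately show ?thesis
      by (simp add: off_axes_def dvd_mod_iff)
  qed
  then have off_all: "off_axes p w" if "w \<in> {(a, b), (c, d), (?e, ?f)}" for w
    using that off by auto
  have carr_W: "{(a, b), (c, d), (?e, ?f)} \<subseteq> carrier ?G"
    using carr p1 by (simp add: carrier_zmod_square)
  have gen_W: "generating_system ?G ((a, b), (c, d), (?e, ?f))"
    by (rule generating_system_zmod_square[OF p carr_W det]) (simp_all add: dvd_eq_mod_eq_0 mod_simps)
  have "group.ord ?G w = p" if "w \<in> {(a, b), (c, d), (?e, ?f)}" for w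
    using that carr_W off_all[OF that] by (intro ord_zmod_square[OF p]) (auto simp: off_axes_def)
  then have type_W: "type_of ?G ((a, b), (c, d), (?e, ?f)) = (p, p, p)"
    by simp
  have gen_E: "generating_system ?G (standard_system p)"
    by (rule generating_standard_system[OF p])
  have carr_E: "{(1, 0), (0, 1), (int p - 1, int p - 1)} \<subseteq> carrier ?G"
    using p1 by (simp add: carrier_zmod_square)
  then have type_E: "type_of ?G (standard_system p) = (p, p, p)"
    using p1 ord_zmod_square[OF p] by (simp add: standard_system_def)
  have "disjoint_systems ?G (standard_system p) ((a, b), (c, d), (?e, ?f))"
    unfolding standard_system_def
  proof (rule disjoint_systems_zmod_square[OF p])
    show "{(1, 0), (0, 1), (int p - 1, int p - 1), (a, b), (c, d), (?e, ?f)} \<subseteq> carrier ?G"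
      using carr_E carr_W by blast
  next
    fix v w :: "int \<times> int"
    assume v: "v \<in> {(1, 0), (0, 1), (int p - 1, int p - 1)}" and "w \<in> {(a, b), (c, d), (?e, ?f)}"
    then have w: "off_axes p w" using off_all by blast
    obtain x y where xy: "w = (x, y)" by (cases w)
    have "\<not> int p dvd int p - 1"
      using p1 by (simp add: dvd_diff_right_iff)
    then have "\<not> int p dvd (int p - 1) * (y - x)"
      using w prime by (auto simp: off_axes_def xy prime_dvd_mult_iff)
    then show "\<not> int p dvd fst v * snd w - snd v * fst w"
      using v w by (auto simp: xy off_axes_def right_diff_distrib)
  qed
  then show ?thesis
    using gen_E gen_W type_E type_W by (simp add: disjoint_pairs_def of_unordered_type_def)
qed

lemma mult_le_card_Sigma:
  assumes "finite A" "m \<le> card A" "\<And>x. x \<in> A \<Longrightarrow> finite (B x) \<and> n \<le> card (B x)"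
  shows "m * n \<le> card (Sigma A B)"
proof -
  have "m * n \<le> card A * n" using assms(2) by simp
  also have "\<dots> \<le> (\<Sum>x\<in>A. card (B x))"
    using sum_bounded_below[of A n "\<lambda>x. card (B x)"] assms(3) by simp
  also have "\<dots> = card (Sigma A B)" using assms(1,3) by (intro card_SigmaI[symmetric]) auto
  finally show ?thesis .
qed

text \<open>The number five is the most values that any single entry has to avoid below.\<close>

lemma card_residues_avoiding:
  assumes "length xs \<le> 5"
  shows "p - 5 \<le> card ({0..<int p} - set xs)"
proof -
  have "p - 5 \<le> card {0..<int p} - card (set xs)"
    using assms card_length[of xs] by simp
  also have "\<dots> \<le> card ({0..<int p} - set xs)" by (rule diff_card_le_card_Diff) simp
  finally show ?thesis .
qed

text \<open>
  The entries are chosen in the order \<open>a\<close>, \<open>b\<close>, \<open>c\<close>, \<open>d\<close>. Each condition on the matrix then excludes at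
  most one value of the entry chosen last among those that it involves, provided that \<open>a\<close> is
  invertible, which is needed to solve \<open>a d = b c\<close> for \<open>d\<close>.
\<close>

lemma card_disjoint_from_standard_system:
  assumes p: "Factorial_Ring.prime (p::nat)"
  shows "(p - 5) ^ 4 \<le> card {W. (standard_system p, W) \<in> disjoint_pairs (zmod_square p) (p, p, p) (p, p, p)}"
    (is "_ \<le> card ?F")
proof -
  let ?R = "{0..<int p}"
  have p1: "1 < p" using p prime_gt_1_nat by blast
  have prime: "Factorial_Ring.prime (int p)" using p by simp
  have "\<exists>k. [a * k = 1] (mod int p)" if "\<not> int p dvd a" for a
    using prime_imp_coprime[OF prime that] by (intro cong_solve_coprime_int) (rule coprime_commute[THEN iffD1])
  then obtain inverse where inverse: "\<And>a. \<not> int p dvd a \<Longrightarrow> [a * inverse a = 1] (mod int p)"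
    by metis
  \<comment> \<open>The allowed values of each entry, given the earlier ones. For \<open>d\<close> the five exclusions come, in this
    order, from the lines of slopes \<open>0\<close> and \<open>1\<close> for \<open>(c, d)\<close>, the same two lines for the third vector,
    and the determinant.\<close>
  define A where "A = ?R - set [0]"
  define B where "B = (\<lambda>a. ?R - set [0, a])"
  define C where "C = (\<lambda>a. ?R - set [0, (- a) mod int p])"
  define D where "D = (\<lambda>a b c. ?R - set [0, c, (- b) mod int p, (a + c - b) mod int p,
    (b * c * inverse a) mod int p])"
  define S where "S = Sigma A (\<lambda>a. Sigma (B a) (\<lambda>b. Sigma (C a) (D a b)))"
  define w where "w = (\<lambda>(a, b, c, d). ((a, b), (c, d), ((- a - c) mod int p, (- b - d) mod int p)))"
  have fin: "finite A" "finite (B a)" "finite (C a)" "finite (D a b c)" for a b c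
    by (simp_all add: A_def B_def C_def D_def)
  have card: "p - 5 \<le> card A" "p - 5 \<le> card (B a)" "p - 5 \<le> card (C a)" "p - 5 \<le> card (D a b c)"
    for a b c
    unfolding A_def B_def C_def D_def by (rule card_residues_avoiding; simp)+
  have "(p - 5) * ((p - 5) * ((p - 5) * (p - 5))) \<le> card S"
    unfolding S_def using fin card
    by (intro mult_le_card_Sigma conjI finite_SigmaI) simp_all
  also have "card S = card (w ` S)"
    by (intro card_image[symmetric] inj_onI) (auto simp: w_def)
  also have "\<dots> \<le> card ?F"
  proof (rule card_mono)
    have "?F \<subseteq> triples (zmod_square p)"
      using disjoint_pairs_subset[of "zmod_square p" "(p, p, p)" "(p, p, p)"] by blast
    then show "finite ?F"
      by (rule finite_subset) (use p1 in \<open>simp add: finite_zmod_square\<close>)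
    show "w ` S \<subseteq> ?F"
    proof (rule image_subsetI)
      fix v assume "v \<in> S"
      moreover obtain a b c d where v: "v = (a, b, c, d)" by (cases v)
      ultimately have a: "a \<in> ?R" "a \<noteq> 0" and b: "b \<in> ?R" "b \<noteq> 0" "b \<noteq> a"
        and c: "c \<in> ?R" "c \<noteq> 0" "c \<noteq> (- a) mod int p"
        and d: "d \<in> ?R" "d \<noteq> 0" "d \<noteq> c" "d \<noteq> (- b) mod int p" "d \<noteq> (a + c - b) mod int p"
          "d \<noteq> (b * c * inverse a) mod int p"
        unfolding v S_def A_def B_def C_def D_def
        by (simp_all only: mem_Sigma_iff Diff_iff list.set insert_iff empty_iff de_Morgan_disj simp_thms)
      have neq: "\<not> int p dvd x - y" if "x \<in> ?R" "x \<noteq> y mod int p" for x y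
        using that by (auto simp: mod_eq_dvd_iff [symmetric])
      have R: "x mod int p = x" if "x \<in> ?R" for x using that by simp
      have "\<not> int p dvd a" using neq[of a 0] a by simp
      have "\<not> int p dvd a * d - b * c"
      proof
        assume "int p dvd a * d - b * c"
        then have "[a * d = b * c] (mod int p)" by (simp add: cong_iff_dvd_diff)
        then have "[a * d * inverse a = b * c * inverse a] (mod int p)" by (rule cong_scalar_right)
        moreover have "[a * inverse a * d = 1 * d] (mod int p)"
          using inverse[OF \<open>\<not> int p dvd a\<close>] by (rule cong_scalar_right)
        ultimately have "[d = b * c * inverse a] (mod int p)"
          by (simp add: cong_def algebra_simps)
        then show False using d(1,6) by (simp add: cong_def)
      qed
      moreover have "off_axes p (a, b)"
        using neq[of a 0] neq[of b 0] neq[of b a] a b R by (simp add: off_axes_def)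
      moreover have "off_axes p (c, d)"
        using neq[of c 0] neq[of d 0] neq[of d c] c d R by (simp add: off_axes_def)
      moreover have "off_axes p (a + c, b + d)"
        using neq[of c "- a"] neq[of d "- b"] neq[of d "a + c - b"] c d
        by (simp add: off_axes_def algebra_simps)
      moreover have "{(a, b), (c, d)} \<subseteq> carrier (zmod_square p)"
        using a b c d p1 by (simp add: carrier_zmod_square)
      ultimately show "w v \<in> ?F"
        unfolding v w_def prod.case mem_Collect_eq by (intro standard_system_disjoint_pair[OF p])
    qed
  qed
  finally show ?thesis by (simp add: power4_eq_xxxx mult.assoc)
qed

lemma hurwitz_number_zmod_square_bounds:
  assumes p: "Factorial_Ring.prime (p::nat)"
  shows "(p - 5) ^ 4 \<le> 72 * hurwitz_number (zmod_square p) (p, p, p)"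
    and "hurwitz_number (zmod_square p) (p, p, p) \<le> p ^ 4"
proof -
  let ?G = "zmod_square p"
  have p1: "1 < p" using p prime_gt_1_nat by blast
  then have fin: "finite (carrier ?G)" by (simp add: finite_zmod_square)
  have E: "generating_system ?G (standard_system p)" by (rule generating_standard_system[OF p])
  show "(p - 5) ^ 4 \<le> 72 * hurwitz_number ?G (p, p, p)"
    using card_disjoint_from_standard_system[OF p]
      card_disjoint_from_le_hurwitz_number[OF comm_group_zmod_square fin E] by (rule order_trans)
  have "hurwitz_number ?G (p, p, p) \<le> (order ?G)\<^sup>2"
    using iso_from_standard_system[OF p1]
    by (intro hurwitz_number_le[OF group_zmod_square fin generating_system_in_triples[OF E]])
       (simp add: of_unordered_type_def)
  then show "hurwitz_number ?G (p, p, p) \<le> p ^ 4"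
    using p1 by (simp add: order_zmod_square flip: power_mult)
qed

lemma euler_char_zmod_square:
  assumes "0 < p" and "beauville_structure (zmod_square p) (p, p, p) (p, p, p) V"
  shows "euler_char (zmod_square p) V = (real p - 3)\<^sup>2 / 4"
proof -
  obtain V1 V2 where V: "V = (V1, V2)" by (cases V)
  have "type_of (zmod_square p) V1 = (p, p, p)" "type_of (zmod_square p) V2 = (p, p, p)"
    using assms(2) by (simp_all add: V of_type_def)
  then show ?thesis
    using assms(1) by (simp add: V order_zmod_square field_simps power2_eq_square)
qed

theorem corollary4p10:
  fixes S :: "nat \<Rightarrow> (int \<times> int) triple \<times> (int \<times> int) triple"
  assumes S: "\<And>p. Factorial_Ring.prime p \<Longrightarrow> 5 \<le> p \<Longrightarrow>
      beauville_structure (zmod_square p) (p, p, p) (p, p, p) (S p)"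
  shows "(\<lambda>p. real (hurwitz_number (zmod_square p) (p, p, p)))
      \<in> \<Theta>[inf at_top (principal {p. Factorial_Ring.prime p \<and> 5 \<le> p})](\<lambda>p. (euler_char (zmod_square p) (S p))\<^sup>2)"
proof -
  let ?F = "inf at_top (principal {p::nat. Factorial_Ring.prime p \<and> 5 \<le> p})"
  let ?h = "\<lambda>p. real (hurwitz_number (zmod_square p) (p, p, p))"
  let ?\<chi> = "\<lambda>p. euler_char (zmod_square p) (S p)"
  \<comment> \<open>For \<open>p \<ge> 7\<close> both \<open>p \<le> 2 (p - 3)\<close> and \<open>p - 3 \<le> 2 (p - 5)\<close>, which yields the two constants.\<close>
  have bounds: "?h p \<le> 256 * (?\<chi> p)\<^sup>2 \<and> (?\<chi> p)\<^sup>2 \<le> 72 * ?h p"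
    if p: "Factorial_Ring.prime p" "7 \<le> p" for p
  proof -
    have \<chi>: "?\<chi> p = (real p - 3)\<^sup>2 / 4"
      using p by (intro euler_char_zmod_square S) auto
    have "?h p \<le> real p ^ 4"
      using hurwitz_number_zmod_square_bounds(2)[OF p(1)] by (simp flip: of_nat_power)
    also have "\<dots> \<le> (2 * (real p - 3)) ^ 4"
      using p(2) by (intro power_mono) auto
    also have "\<dots> = 256 * (?\<chi> p)\<^sup>2"
      unfolding \<chi> by (simp only: power_divide power_mult_distrib flip: power_mult) simp
    finally have upper: "?h p \<le> 256 * (?\<chi> p)\<^sup>2" .
    have "(?\<chi> p)\<^sup>2 = ((real p - 3) / 2) ^ 4"
      by (simp add: \<chi> power_divide flip: power_mult)
    also have "\<dots> \<le> real (p - 5) ^ 4"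
      using p(2) by (intro power_mono) auto
    also have "\<dots> \<le> 72 * ?h p"
      using hurwitz_number_zmod_square_bounds(1)[OF p(1)]
      by (metis of_nat_le_iff of_nat_mult of_nat_numeral of_nat_power)
    finally show ?thesis using upper by blast
  qed
  have ev: "\<forall>\<^sub>F p in ?F. ?h p \<le> 256 * (?\<chi> p)\<^sup>2 \<and> (?\<chi> p)\<^sup>2 \<le> 72 * ?h p"
    unfolding eventually_inf_principal
    by (rule eventually_mono[OF eventually_ge_at_top[of 7]]) (use bounds in auto)
  show ?thesis
  proof (rule bigthetaI)
    show "?h \<in> O[?F](\<lambda>p. (?\<chi> p)\<^sup>2)"
      using ev by (intro bigoI[of _ 256]) (auto elim: eventually_mono)
    show "?h \<in> \<Omega>[?F](\<lambda>p. (?\<chi> p)\<^sup>2)"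
      using ev by (intro landau_omega.bigI[of "1 / 72"]) (auto elim: eventually_mono)
  qed
qed

end
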